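(* Let $A, B$ be normal $n \times n$ complex matrices. Then $AB$ is unitarily similar to $BA$ whenever at least one of the following holds: (i) $n \leq 2$; (ii) $\operatorname{rank}(A) \leq 1$.
   Context: $X^*$ denotes the conjugate transpose of a complex matrix $X$. A square complex matrix $X$ is normal if $XX^* = X^*X$. Two $n \times n$ complex matrices $X, Y$ are unitarily similar if there is an $n \times n$ unitary matrix $U$ with $UX = YU$. *)

theory Defs
  imports
    "Jordan_Normal_Form.Schur_Decomposition"
    "Jordan_Normal_Form.DL_Rank"
begin

definition normal_mat :: "complex mat \<Rightarrow> bool" where
  "normal_mat X \<longleftrightarrow> square_mat X \<and> X * mat_adjoint X = mat_adjoint X * X"

definition unitary_mat :: "complex mat \<Rightarrow> bool" where
  "unitary_mat U \<longleftrightarrow> square_mat U \<and>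
     U * mat_adjoint U = 1\<^sub>m (dim_row U) \<and> mat_adjoint U * U = 1\<^sub>m (dim_row U)"

definition unitarily_similar :: "nat \<Rightarrow> complex mat \<Rightarrow> complex mat \<Rightarrow> bool" where
  "unitarily_similar n X Y \<longleftrightarrow> X \<in> carrier_mat n n \<and> Y \<in> carrier_mat n n \<and>
     (\<exists>U \<in> carrier_mat n n. unitary_mat U \<and> U * X = Y * U)"

end

theory Submission
  imports Defs
begin

text \<open>
  Write \<open>p q\<^sup>*\<close> for the outer product \<open>outer_prod p q\<close>. In both cases of the theorem there is one
  scalar \<open>c\<close> such that \<open>A B = c I + p q\<^sup>*\<close> and \<open>B A = c I + p' q'\<^sup>*\<close>. If \<open>A\<close> has rank at most one,
  as it always does for \<open>n \<le> 1\<close>, then \<open>A = p q\<^sup>*\<close> and \<open>c = 0\<close> works, since \<open>A B = p (B\<^sup>* q)\<^sup>*\<close> and \<open>B A = (B p) q\<^sup>*\<close>. If \<open>n = 2\<close>,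
  then \<open>c\<close> can be an eigenvalue of \<open>A B\<close>: the products share their trace and determinant, so
  both \<open>A B - c I\<close> and \<open>B A - c I\<close> are singular, and a singular \<open>2 \<times> 2\<close> matrix is an outer
  product.

  For such matrices, unitary similarity is decided by the trace of \<open>X\<close> and the trace of
  \<open>X X\<^sup>*\<close>. These two numbers fix \<open>\<langle>p, q\<rangle>\<close> and the product of \<open>\<parallel>p\<parallel>\<^sup>2\<close> and \<open>\<parallel>q\<parallel>\<^sup>2\<close>. As \<open>p\<close> may be rescaled
  at the expense of \<open>q\<close>, the pairs \<open>(p, q)\<close> and \<open>(p', q')\<close> can be given the same Gram matrix, and
  then some unitary \<open>U\<close> maps one pair to the other (\<open>ex_unitary_same_gram\<close>), so that
  \<open>U p q\<^sup>* U\<^sup>* = p' q'\<^sup>*\<close>.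

  The trace of \<open>A B\<close> always equals that of \<open>B A\<close>. Normality enters for the other invariant:
  the trace of \<open>A B B\<^sup>* A\<^sup>*\<close> is that of \<open>(A\<^sup>* A) (B B\<^sup>*)\<close>, while the trace of \<open>B A A\<^sup>* B\<^sup>*\<close> is that of
  \<open>(A A\<^sup>*) (B\<^sup>* B)\<close> (\<open>normal_products_same_frobenius_norm\<close>).
\<close>

section \<open>Adjoints and traces\<close>

lemma mat_adjoint_dim [simp]:
  "dim_row (mat_adjoint A) = dim_col A" "dim_col (mat_adjoint A) = dim_row A"
  by (simp_all add: mat_adjoint_def)

lemma mat_adjoint_carrier:
  "A \<in> carrier_mat n m \<Longrightarrow> mat_adjoint A \<in> carrier_mat m n"
  by (intro carrier_matI) simp_all

lemma mat_adjoint_index [simp]: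
  fixes A :: "complex mat"
  assumes "i < dim_col A" "j < dim_row A"
  shows "mat_adjoint A $$ (i, j) = cnj (A $$ (j, i))"
  using assms unfolding mat_adjoint_def by (auto simp: mat_of_rows_index)

lemma mat_adjoint_mult:
  fixes A B :: "complex mat"
  assumes A: "A \<in> carrier_mat n m" and B: "B \<in> carrier_mat m k"
  shows "mat_adjoint (A * B) = mat_adjoint B * mat_adjoint A"
  by (rule eq_matI) (use A B in \<open>auto simp: scalar_prod_def mult.commute intro!: sum.cong\<close>)

lemma mat_adjoint_one: "mat_adjoint (1\<^sub>m n :: complex mat) = 1\<^sub>m n"
  by (rule eq_matI) auto

lemma cscalar_prod_adjoint:
  fixes M :: "complex mat"
  assumes M: "M \<in> carrier_mat n m" and "x \<in> carrier_vec m" "y \<in> carrier_vec n"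
  shows "(M *\<^sub>v x) \<bullet>c y = x \<bullet>c (mat_adjoint M *\<^sub>v y)"
proof -
  have "(M *\<^sub>v x) \<bullet>c y = (\<Sum>i<n. \<Sum>j<m. M $$ (i, j) * x $ j * cnj (y $ i))"
    using assms by (auto simp: scalar_prod_def sum_distrib_right lessThan_atLeast0 intro!: sum.cong)
  also have "\<dots> = (\<Sum>j<m. \<Sum>i<n. M $$ (i, j) * x $ j * cnj (y $ i))"
    by (rule sum.swap)
  also have "\<dots> = x \<bullet>c (mat_adjoint M *\<^sub>v y)"
    using assms
    by (auto simp: scalar_prod_def sum_distrib_left lessThan_atLeast0 mult_ac intro!: sum.cong)
  finally show ?thesis .
qed

lemma cscalar_prod_commute:
  fixes x y :: "complex vec"
  assumes "x \<in> carrier_vec n" "y \<in> carrier_vec n"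
  shows "y \<bullet>c x = cnj (x \<bullet>c y)"
  using assms by (auto simp: scalar_prod_def mult.commute intro!: sum.cong)

definition mat_trace :: "complex mat \<Rightarrow> complex" where
  "mat_trace A = (\<Sum>i<dim_row A. A $$ (i, i))"

lemma mat_trace_mult_commute:
  assumes "A \<in> carrier_mat n m" "B \<in> carrier_mat m n"
  shows "mat_trace (A * B) = mat_trace (B * A)"
proof -
  have "mat_trace (A * B) = (\<Sum>i<n. \<Sum>j<m. A $$ (i, j) * B $$ (j, i))"
    using assms by (auto simp: mat_trace_def scalar_prod_def lessThan_atLeast0 intro!: sum.cong)
  also have "\<dots> = (\<Sum>j<m. \<Sum>i<n. A $$ (i, j) * B $$ (j, i))"
    by (rule sum.swap)
  also have "\<dots> = mat_trace (B * A)"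
    using assms
    by (auto simp: mat_trace_def scalar_prod_def lessThan_atLeast0 mult.commute intro!: sum.cong)
  finally show ?thesis .
qed

lemma mat_trace_mult_adjoint:
  assumes "A \<in> carrier_mat n m"
  shows "mat_trace (A * mat_adjoint A) = (\<Sum>i<n. \<Sum>j<m. A $$ (i, j) * cnj (A $$ (i, j)))"
  using assms by (auto simp: mat_trace_def scalar_prod_def lessThan_atLeast0 intro!: sum.cong)

text \<open>
  Cyclic invariance of the trace brings the two factors of each of \<open>A\<close> and \<open>B\<close> next to each other,
  where normality allows them to be exchanged.
\<close>

lemma normal_products_same_frobenius_norm:
  assumes A: "A \<in> carrier_mat n n" and B: "B \<in> carrier_mat n n"
    and nA: "normal_mat A" and nB: "normal_mat B"
  shows "mat_trace (A * B * mat_adjoint (A * B)) = mat_trace (B * A * mat_adjoint (B * A))"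
proof -
  note A' = mat_adjoint_carrier[OF A] and B' = mat_adjoint_carrier[OF B]
  have swap: "mat_trace (X * Y * mat_adjoint (X * Y))
      = mat_trace ((Y * mat_adjoint Y) * (mat_adjoint X * X))"
    if X: "X \<in> carrier_mat n n" and Y: "Y \<in> carrier_mat n n" for X Y
  proof -
    note X' = mat_adjoint_carrier[OF X] and Y' = mat_adjoint_carrier[OF Y]
    have "X * Y * mat_adjoint (X * Y) = X * (Y * mat_adjoint Y * mat_adjoint X)"
      using X Y X' Y' by (simp add: mat_adjoint_mult[OF X Y] assoc_mult_mat[of _ n n _ n _ n])
    moreover have "mat_trace (X * (Y * mat_adjoint Y * mat_adjoint X))
        = mat_trace ((Y * mat_adjoint Y * mat_adjoint X) * X)"
      using X Y X' Y' by (intro mat_trace_mult_commute) auto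
    ultimately show ?thesis
      using X Y X' Y' by (simp add: assoc_mult_mat[of _ n n _ n _ n])
  qed
  have "mat_trace ((B * mat_adjoint B) * (mat_adjoint A * A))
      = mat_trace ((mat_adjoint A * A) * (B * mat_adjoint B))"
    using A B A' B' by (intro mat_trace_mult_commute) auto
  thus ?thesis
    using nA nB by (simp add: swap[OF A B] swap[OF B A] normal_mat_def)
qed

section \<open>Unitary matrices with prescribed values\<close>

lemma unitary_mat_mult:
  assumes U: "U \<in> carrier_mat n n" and V: "V \<in> carrier_mat n n"
    and uU: "unitary_mat U" and uV: "unitary_mat V"
  shows "unitary_mat (U * V)"
proof -
  note U' = mat_adjoint_carrier[OF U] and V' = mat_adjoint_carrier[OF V]
  have u: "U * mat_adjoint U = 1\<^sub>m n" "mat_adjoint U * U = 1\<^sub>m n"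
      "V * mat_adjoint V = 1\<^sub>m n" "mat_adjoint V * V = 1\<^sub>m n"
    using uU uV U V by (auto simp: unitary_mat_def)
  have "U * V * (mat_adjoint V * mat_adjoint U) = U * (V * mat_adjoint V) * mat_adjoint U"
    using U V U' V' by (simp add: assoc_mult_mat[of _ n n _ n _ n])
  also have "\<dots> = 1\<^sub>m n" using U u by simp
  finally have 1: "U * V * mat_adjoint (U * V) = 1\<^sub>m n" by (simp add: mat_adjoint_mult[OF U V])
  have "mat_adjoint V * mat_adjoint U * (U * V)
      = mat_adjoint V * (mat_adjoint U * U) * V"
    using U V U' V' by (simp add: assoc_mult_mat[of _ n n _ n _ n])
  also have "\<dots> = 1\<^sub>m n" using V V' u by simp
  finally have "mat_adjoint (U * V) * (U * V) = 1\<^sub>m n" by (simp add: mat_adjoint_mult[OF U V])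
  with 1 show ?thesis using U V by (simp add: unitary_mat_def)
qed

lemma unitary_mat_one: "unitary_mat (1\<^sub>m n)"
  using left_mult_one_mat[OF one_carrier_mat[of n]]
  unfolding unitary_mat_def mat_adjoint_one by simp

lemma unitary_mat_adjoint_cancel:
  assumes U: "U \<in> carrier_mat n n" "unitary_mat U" and x: "x \<in> carrier_vec n"
  shows "mat_adjoint U *\<^sub>v (U *\<^sub>v x) = x"
proof -
  have "mat_adjoint U *\<^sub>v (U *\<^sub>v x) = (mat_adjoint U * U) *\<^sub>v x"
    by (rule assoc_mult_mat_vec[symmetric, OF mat_adjoint_carrier[OF U(1)] U(1) x])
  also have "mat_adjoint U * U = 1\<^sub>m n"
    using U by (simp add: unitary_mat_def)
  finally show ?thesis using x by simp
qed

lemma unitary_mat_cscalar_prod: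
  assumes U: "U \<in> carrier_mat n n" "unitary_mat U"
    and x: "x \<in> carrier_vec n" and y: "y \<in> carrier_vec n"
  shows "(U *\<^sub>v x) \<bullet>c (U *\<^sub>v y) = x \<bullet>c y"
  using cscalar_prod_adjoint[OF U(1) x, of "U *\<^sub>v y"] U x y
  by (simp add: unitary_mat_adjoint_cancel)

definition outer_prod :: "complex vec \<Rightarrow> complex vec \<Rightarrow> complex mat" where
  "outer_prod p q = mat (dim_vec p) (dim_vec q) (\<lambda>(i, j). p $ i * cnj (q $ j))"

lemma outer_prod_carrier [simp]:
  "p \<in> carrier_vec n \<Longrightarrow> q \<in> carrier_vec m \<Longrightarrow> outer_prod p q \<in> carrier_mat n m"
  by (auto simp: outer_prod_def)

lemma outer_prod_index [simp]:
  "i < dim_vec p \<Longrightarrow> j < dim_vec q \<Longrightarrow> outer_prod p q $$ (i, j) = p $ i * cnj (q $ j)"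
  by (simp add: outer_prod_def)

lemma mult_outer_prod:
  assumes "M \<in> carrier_mat k n" "p \<in> carrier_vec n" "q \<in> carrier_vec m"
  shows "M * outer_prod p q = outer_prod (M *\<^sub>v p) q"
  by (rule eq_matI)
    (use assms in \<open>auto simp: outer_prod_def scalar_prod_def sum_distrib_right intro!: sum.cong\<close>)

lemma outer_prod_mult:
  assumes M: "M \<in> carrier_mat m k" and "p \<in> carrier_vec n" "q \<in> carrier_vec m"
  shows "outer_prod p q * M = outer_prod p (mat_adjoint M *\<^sub>v q)"
  by (rule eq_matI)
    (use assms in \<open>auto simp: outer_prod_def scalar_prod_def sum_distrib_left mult_ac
      intro!: sum.cong\<close>)

lemma outer_prod_mult_vec:
  assumes "p \<in> carrier_vec n" "q \<in> carrier_vec m" "x \<in> carrier_vec m"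
  shows "outer_prod p q *\<^sub>v x = (x \<bullet>c q) \<cdot>\<^sub>v p"
  by (rule eq_vecI)
    (use assms in \<open>auto simp: outer_prod_def scalar_prod_def sum_distrib_left mult_ac intro!: sum.cong\<close>)

lemma outer_prod_mult_outer_prod:
  assumes "p \<in> carrier_vec n" "q \<in> carrier_vec m" "r \<in> carrier_vec m" "s \<in> carrier_vec k"
  shows "outer_prod p q * outer_prod r s = (r \<bullet>c q) \<cdot>\<^sub>m outer_prod p s"
  by (rule eq_matI)
    (use assms in \<open>auto simp: outer_prod_def scalar_prod_def sum_distrib_right sum_distrib_left
      mult_ac intro!: sum.cong\<close>)

text \<open>
  The identity on the orthogonal complement of \<open>z\<close>, and a multiplication on the line through \<open>z\<close>.
  The scalar \<open>c\<close> is an arbitrary complex number, because complex multipliers on the line are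
  needed to map a vector to another one of the same length; for nonzero \<open>z\<close>, the choice
  \<open>c = 2 / \<parallel>z\<parallel>\<^sup>2\<close> is the Householder reflection.
\<close>

definition reflection :: "nat \<Rightarrow> complex \<Rightarrow> complex vec \<Rightarrow> complex mat" where
  "reflection n c z = 1\<^sub>m n - c \<cdot>\<^sub>m outer_prod z z"

lemma reflection_dim [simp]:
  "dim_row (reflection n c z) = dim_vec z" "dim_col (reflection n c z) = dim_vec z"
  by (simp_all add: reflection_def outer_prod_def)

lemma reflection_carrier:
  "z \<in> carrier_vec n \<Longrightarrow> reflection n c z \<in> carrier_mat n n"
  by (intro carrier_matI) simp_all

lemma mat_adjoint_reflection:
  assumes z: "z \<in> carrier_vec n"
  shows "mat_adjoint (reflection n c z) = reflection n (cnj c) z"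
  by (rule eq_matI) (use z in \<open>auto simp: reflection_def outer_prod_def\<close>)

lemma reflection_mult_vec:
  assumes z: "z \<in> carrier_vec n" and x: "x \<in> carrier_vec n"
  shows "reflection n c z *\<^sub>v x = x - (c * (x \<bullet>c z)) \<cdot>\<^sub>v z"
proof -
  have "reflection n c z *\<^sub>v x = 1\<^sub>m n *\<^sub>v x - (c \<cdot>\<^sub>m outer_prod z z) *\<^sub>v x"
    unfolding reflection_def using z x
    by (intro minus_mult_distrib_mat_vec[of _ n n]) auto
  also have "(c \<cdot>\<^sub>m outer_prod z z) *\<^sub>v x = c \<cdot>\<^sub>v (outer_prod z z *\<^sub>v x)"
    using z x by (intro eq_vecI) (auto simp: scalar_prod_def sum_distrib_left mult_ac outer_prod_def)
  finally show ?thesis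
    using z x by (simp add: outer_prod_mult_vec smult_smult_assoc)
qed

lemma reflection_mult_reflection:
  assumes z: "z \<in> carrier_vec n" and cd: "c + d = c * d * (z \<bullet>c z)"
  shows "reflection n c z * reflection n d z = 1\<^sub>m n"
proof (rule eq_matI)
  let ?O = "outer_prod z z"
  have O: "?O \<in> carrier_mat n n" using z by simp
  have OO: "?O * ?O = (z \<bullet>c z) \<cdot>\<^sub>m ?O" by (rule outer_prod_mult_outer_prod[OF z z z z])
  fix i j assume "i < dim_row (1\<^sub>m n :: complex mat)" "j < dim_col (1\<^sub>m n :: complex mat)"
  hence ij: "i < n" "j < n" by auto
  have "reflection n c z * reflection n d z
      = reflection n c z - reflection n c z * (d \<cdot>\<^sub>m ?O)"
    unfolding reflection_def[of n d] using O z
    by (subst mult_minus_distrib_mat[of _ n n _ n]) (auto simp: right_mult_one_mat[of _ n n])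
  also have "reflection n c z * (d \<cdot>\<^sub>m ?O) = d \<cdot>\<^sub>m ?O - (c \<cdot>\<^sub>m ?O) * (d \<cdot>\<^sub>m ?O)"
    unfolding reflection_def using O
    by (subst minus_mult_distrib_mat[of _ n n _ _ n]) auto
  also have "(c \<cdot>\<^sub>m ?O) * (d \<cdot>\<^sub>m ?O) = d \<cdot>\<^sub>m (c \<cdot>\<^sub>m ((z \<bullet>c z) \<cdot>\<^sub>m ?O))"
    using O OO by (simp add: mult_smult_distrib[of _ n n _ n] mult_smult_assoc_mat[of _ n n _ n])
  finally have "(reflection n c z * reflection n d z) $$ (i, j)
      = (1\<^sub>m n) $$ (i, j) - (c + d - c * d * (z \<bullet>c z)) * ?O $$ (i, j)"
    using O ij by (simp add: reflection_def algebra_simps)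
  thus "(reflection n c z * reflection n d z) $$ (i, j) = 1\<^sub>m n $$ (i, j)"
    using cd by simp
qed (use z in auto)

text \<open>
  With \<open>z = x - y\<close> and \<open>s = \<langle>x, z\<rangle>\<close>, the matrix \<open>I - (1 / s) z z\<^sup>*\<close> sends \<open>x\<close> to \<open>x - z = y\<close>. It is
  unitary because equality of the lengths says exactly \<open>\<parallel>z\<parallel>\<^sup>2 = 2 Re s\<close>. It fixes all vectors
  orthogonal to \<open>x - y\<close>, so that a second vector can be moved later without disturbing the first.
\<close>

lemma ex_unitary_reflection:
  assumes x: "x \<in> carrier_vec n" and y: "y \<in> carrier_vec n" and xy: "x \<bullet>c x = y \<bullet>c y"
  shows "\<exists>H \<in> carrier_mat n n. unitary_mat H \<and> H *\<^sub>v x = y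
    \<and> (\<forall>w \<in> carrier_vec n. w \<bullet>c (x - y) = 0 \<longrightarrow> H *\<^sub>v w = w)"
proof -
  define z where "z = x - y"
  define s where "s = x \<bullet>c z"
  define H where "H = reflection n (1 / s) z"
  have z: "z \<in> carrier_vec n" using x y by (simp add: z_def)
  have s: "s = x \<bullet>c x - x \<bullet>c y"
    unfolding s_def z_def using x y by (simp add: scalar_prod_def algebra_simps sum_subtractf)
  have cs: "cnj s = x \<bullet>c x - y \<bullet>c x"
    unfolding s using cscalar_prod_commute[OF x y] cscalar_prod_commute[OF x x] by simp
  have "z \<bullet>c z = x \<bullet>c x - x \<bullet>c y - (y \<bullet>c x - y \<bullet>c y)"
    unfolding z_def using x y
    by (simp add: scalar_prod_def algebra_simps sum_subtractf sum.distrib)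
  \<comment> \<open>If \<open>s = 0\<close>, then this forces \<open>z = 0\<close>; as \<open>1 / 0 = 0\<close>, the reflection is the identity, as wanted.\<close>
  hence zz: "z \<bullet>c z = s + cnj s" using s cs xy by simp
  have sz: "z = 0\<^sub>v n" if "s = 0"
    using zz that conjugate_square_eq_0_vec[OF z] by simp
  have 1: "1 / s + 1 / cnj s = 1 / s * (1 / cnj s) * (z \<bullet>c z)"
    unfolding zz by (cases "s = 0") (auto simp: field_simps)
  have H: "H \<in> carrier_mat n n" using reflection_carrier[OF z] by (simp add: H_def)
  have "mat_adjoint H = reflection n (1 / cnj s) z"
    using mat_adjoint_reflection[OF z] by (simp add: H_def)
  hence "H * mat_adjoint H = 1\<^sub>m n" "mat_adjoint H * H = 1\<^sub>m n"
    unfolding H_def using reflection_mult_reflection[OF z] 1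
    by (simp_all add: add.commute mult.commute)
  hence "unitary_mat H" using H by (simp add: unitary_mat_def)
  moreover have "H *\<^sub>v x = y"
  proof (cases "s = 0")
    case True
    hence "x - y = 0\<^sub>v n" using sz z_def by simp
    hence "x $ i = y $ i" if "i < n" for i
      using x y that by (metis carrier_vecD eq_iff_diff_eq_0 index_minus_vec(1) index_zero_vec(1))
    hence "x = y" using x y by auto
    thus ?thesis using True x z by (auto simp: H_def reflection_mult_vec)
  next
    case False
    have "H *\<^sub>v x = x - z"
      unfolding H_def using False x z by (simp add: reflection_mult_vec s_def)
    also have "\<dots> = y" using x y by (auto simp: z_def)
    finally show ?thesis .
  qed
  moreover have "H *\<^sub>v w = w" if "w \<in> carrier_vec n" "w \<bullet>c (x - y) = 0" for w
    unfolding H_def using that z by (auto simp: reflection_mult_vec z_def[symmetric])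
  ultimately show ?thesis using H by blast
qed

text \<open>
  Two reflections suffice. The first sends \<open>x\<close> to \<open>x'\<close> and \<open>y\<close> to some \<open>w\<close>; the second sends \<open>w\<close> to
  \<open>y'\<close>. As the first preserves inner products, \<open>w\<close> and \<open>y'\<close> have the same inner product with
  \<open>x'\<close>, so \<open>x'\<close> is orthogonal to \<open>w - y'\<close> and the second reflection leaves it in place.
\<close>

lemma ex_unitary_same_gram:
  assumes x: "x \<in> carrier_vec n" and x': "x' \<in> carrier_vec n"
    and y: "y \<in> carrier_vec n" and y': "y' \<in> carrier_vec n"
    and xx: "x \<bullet>c x = x' \<bullet>c x'" and yy: "y \<bullet>c y = y' \<bullet>c y'" and xy: "x \<bullet>c y = x' \<bullet>c y'"
  shows "\<exists>U \<in> carrier_mat n n. unitary_mat U \<and> U *\<^sub>v x = x' \<and> U *\<^sub>v y = y'"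
proof -
  obtain G where G: "G \<in> carrier_mat n n" "unitary_mat G" "G *\<^sub>v x = x'"
    using ex_unitary_reflection[OF x x' xx] by blast
  define w where "w = G *\<^sub>v y"
  have w: "w \<in> carrier_vec n" using G y by (simp add: w_def)
  have ww: "w \<bullet>c w = y' \<bullet>c y'"
    using unitary_mat_cscalar_prod[OF G(1,2) y y] yy by (simp add: w_def)
  obtain H where H: "H \<in> carrier_mat n n" "unitary_mat H" "H *\<^sub>v w = y'"
    and fix_H: "\<And>v. v \<in> carrier_vec n \<Longrightarrow> v \<bullet>c (w - y') = 0 \<Longrightarrow> H *\<^sub>v v = v"
    using ex_unitary_reflection[OF w y' ww] by blast
  have "x' \<bullet>c w = x' \<bullet>c y'"
    using unitary_mat_cscalar_prod[OF G(1,2) x y] xy G(3) by (simp add: w_def)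
  moreover have "x' \<bullet>c (w - y') = x' \<bullet>c w - x' \<bullet>c y'"
    using x' w y' by (simp add: scalar_prod_def algebra_simps sum_subtractf)
  ultimately have "H *\<^sub>v x' = x'" using fix_H[OF x'] by simp
  hence "(H * G) *\<^sub>v x = x'" "(H * G) *\<^sub>v y = y'"
    using G H x y by (auto simp: w_def)
  thus ?thesis using G H unitary_mat_mult[OF H(1) G(1) H(2) G(2)] by auto
qed

section \<open>Perturbations of scalar matrices by outer products\<close>

lemma unitarily_similar_add_scalar:
  assumes "unitarily_similar n P Q"
  shows "unitarily_similar n (c \<cdot>\<^sub>m 1\<^sub>m n + P) (c \<cdot>\<^sub>m 1\<^sub>m n + Q)"
proof -
  from assms obtain U where P: "P \<in> carrier_mat n n" and Q: "Q \<in> carrier_mat n n"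
    and U: "U \<in> carrier_mat n n" "unitary_mat U" "U * P = Q * U"
    unfolding unitarily_similar_def by blast
  have "U * (c \<cdot>\<^sub>m 1\<^sub>m n + P) = U * (c \<cdot>\<^sub>m 1\<^sub>m n) + U * P"
    using U P by (intro mult_add_distrib_mat) auto
  also have "U * (c \<cdot>\<^sub>m 1\<^sub>m n) = (c \<cdot>\<^sub>m 1\<^sub>m n) * U"
    using U by (simp add: mult_smult_distrib[of _ n n _ n] mult_smult_assoc_mat[of _ n n _ n])
  also have "\<dots> + U * P = (c \<cdot>\<^sub>m 1\<^sub>m n + Q) * U"
    unfolding U(3) using U Q by (intro add_mult_distrib_mat[symmetric]) auto
  finally show ?thesis
    unfolding unitarily_similar_def using U P Q by auto
qed

text \<open>
  Only the product of the two lengths is prescribed, because \<open>p q\<^sup>*\<close> does not change when \<open>p\<close> is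
  multiplied by a positive real \<open>t\<close> and \<open>q\<close> is divided by it. When the product is nonzero, a suitable
  \<open>t\<close> makes the lengths agree one by one; when it is zero, both matrices vanish.
\<close>

lemma outer_prod_unitarily_similar:
  assumes p: "p \<in> carrier_vec n" and q: "q \<in> carrier_vec n"
    and p': "p' \<in> carrier_vec n" and q': "q' \<in> carrier_vec n"
    and ip: "p \<bullet>c q = p' \<bullet>c q'"
    and nrm: "(p \<bullet>c p) * (q \<bullet>c q) = (p' \<bullet>c p') * (q' \<bullet>c q')"
  shows "unitarily_similar n (outer_prod p q) (outer_prod p' q')"
proof (cases "(p \<bullet>c p) * (q \<bullet>c q) = 0")
  case True
  have zero: "outer_prod u v = 0\<^sub>m n n"
    if "u \<in> carrier_vec n" "v \<in> carrier_vec n" "(u \<bullet>c u) * (v \<bullet>c v) = 0" for u v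
    using that conjugate_square_eq_0_vec[of u n] conjugate_square_eq_0_vec[of v n]
    by (auto simp: outer_prod_def)
  have "outer_prod p q = 0\<^sub>m n n" "outer_prod p' q' = 0\<^sub>m n n"
    using zero p q p' q' True nrm by auto
  thus ?thesis unfolding unitarily_similar_def
    by (auto intro!: bexI[of _ "1\<^sub>m n"] unitary_mat_one)
next
  case False
  have pos: "\<exists>r > 0. u \<bullet>c u = complex_of_real r"
    if "u \<in> carrier_vec n" "u \<bullet>c u \<noteq> 0" for u :: "complex vec"
  proof -
    have "u \<bullet>c u > 0" using that conjugate_square_greater_0_vec[of u n]
      conjugate_square_eq_0_vec[of u n] by auto
    thus ?thesis by (intro exI[of _ "Re (u \<bullet>c u)"]) (auto simp: less_complex_def complex_eq_iff)
  qed
  obtain r where r: "r > 0" "p \<bullet>c p = complex_of_real r" using pos[OF p] False by auto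
  obtain r' where r': "r' > 0" "p' \<bullet>c p' = complex_of_real r'" using pos[OF p'] False nrm by auto
  \<comment> \<open>\<open>r\<close> and \<open>r'\<close> are squared lengths, so \<open>t\<close> rescales \<open>p'\<close> to the length of \<open>p\<close>.\<close>
  define t where "t = complex_of_real (sqrt (r / r'))"
  have t0: "t \<noteq> 0" using r r' by (simp add: t_def)
  have ct: "cnj t = t" by (simp add: t_def)
  have tt: "t * t * (p' \<bullet>c p') = p \<bullet>c p"
    using r r' by (simp add: t_def flip: of_real_mult of_real_divide)
  have smult: "(a \<cdot>\<^sub>v u) \<bullet>c (b \<cdot>\<^sub>v v) = a * cnj b * (u \<bullet>c v)"
    if "u \<in> carrier_vec n" "v \<in> carrier_vec n" for a b and u v :: "complex vec"
    using that by (simp add: scalar_prod_def sum_distrib_left mult_ac)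
  define p'' where "p'' = t \<cdot>\<^sub>v p'"
  define q'' where "q'' = (1 / t) \<cdot>\<^sub>v q'"
  have pq: "p'' \<in> carrier_vec n" "q'' \<in> carrier_vec n"
    using p' q' by (simp_all add: p''_def q''_def)
  have 1: "p \<bullet>c p = p'' \<bullet>c p''"
    unfolding p''_def smult[OF p' p'] using tt ct by simp
  have "(p \<bullet>c p) * (q'' \<bullet>c q'') = t * t * (p' \<bullet>c p') * (1 / t * cnj (1 / t) * (q' \<bullet>c q'))"
    unfolding q''_def smult[OF q' q'] tt ..
  also have "\<dots> = (p \<bullet>c p) * (q \<bullet>c q)"
    unfolding nrm using t0 ct by (simp add: field_simps)
  finally have 2: "q \<bullet>c q = q'' \<bullet>c q''" using False by simp
  have 3: "p \<bullet>c q = p'' \<bullet>c q''"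
    unfolding p''_def q''_def smult[OF p' q'] ip using t0 ct by simp
  obtain U where U: "U \<in> carrier_mat n n" "unitary_mat U" "U *\<^sub>v p = p''" "U *\<^sub>v q = q''"
    using ex_unitary_same_gram[OF p pq(1) q pq(2) 1 2 3] by blast
  have "outer_prod p' q' = outer_prod p'' q''"
    using p' q' t0 ct by (intro eq_matI) (auto simp: outer_prod_def p''_def q''_def)
  hence "outer_prod p' q' * U = outer_prod p'' (mat_adjoint U *\<^sub>v q'')"
    using outer_prod_mult[OF U(1) pq] by simp
  also have "mat_adjoint U *\<^sub>v q'' = q"
    using unitary_mat_adjoint_cancel[OF U(1,2) q] U(4) by simp
  also have "outer_prod p'' q = U * outer_prod p q"
    using mult_outer_prod[OF U(1) p q] U(3) by simp
  finally show ?thesis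
    unfolding unitarily_similar_def using U p q p' q' by (metis outer_prod_carrier)
qed

lemma mat_trace_scalar_add_outer_prod:
  assumes "p \<in> carrier_vec n" "q \<in> carrier_vec n"
  shows "mat_trace (c \<cdot>\<^sub>m 1\<^sub>m n + outer_prod p q) = of_nat n * c + p \<bullet>c q"
  using assms
  by (auto simp: mat_trace_def outer_prod_def scalar_prod_def sum.distrib lessThan_atLeast0)

text \<open>
  The cross terms depend on \<open>p\<close> and \<open>q\<close> only through their inner product, which the trace already
  determines; what remains is the product of the squared lengths.
\<close>

lemma frobenius_scalar_add_outer_prod:
  fixes c :: complex
  assumes p: "p \<in> carrier_vec n" and q: "q \<in> carrier_vec n"
  defines "X \<equiv> c \<cdot>\<^sub>m 1\<^sub>m n + outer_prod p q"
  shows "mat_trace (X * mat_adjoint X)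
    = of_nat n * c * cnj c + cnj c * (p \<bullet>c q) + c * cnj (p \<bullet>c q) + (p \<bullet>c p) * (q \<bullet>c q)"
proof -
  have X: "X \<in> carrier_mat n n" using p q by (simp add: X_def)
  let ?d = "\<lambda>i j. if i = j then 1 else 0 :: complex"
  have "mat_trace (X * mat_adjoint X) = (\<Sum>i<n. \<Sum>j<n. X $$ (i, j) * cnj (X $$ (i, j)))"
    by (rule mat_trace_mult_adjoint[OF X])
  also have "\<dots> = (\<Sum>i<n. \<Sum>j<n. (if i = j
        then c * cnj c + cnj c * (p $ i * cnj (q $ i)) + c * cnj (p $ i * cnj (q $ i)) else 0)
      + (p $ i * cnj (p $ i)) * (q $ j * cnj (q $ j)))"
    using p q by (intro sum.cong refl) (auto simp: X_def outer_prod_def algebra_simps)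
  also have "\<dots> = (\<Sum>i<n. c * cnj c + cnj c * (p $ i * cnj (q $ i)) + c * cnj (p $ i * cnj (q $ i)))
      + (\<Sum>i<n. p $ i * cnj (p $ i)) * (\<Sum>j<n. q $ j * cnj (q $ j))"
    by (simp add: sum.distrib sum_product)
  also have "\<dots> = of_nat n * c * cnj c + cnj c * (p \<bullet>c q) + c * cnj (p \<bullet>c q)
      + (p \<bullet>c p) * (q \<bullet>c q)"
    using p q by (simp add: scalar_prod_def sum.distrib sum_distrib_left lessThan_atLeast0)
  finally show ?thesis .
qed

lemma scalar_add_outer_prod_unitarily_similar:
  assumes p: "p \<in> carrier_vec n" and q: "q \<in> carrier_vec n"
    and p': "p' \<in> carrier_vec n" and q': "q' \<in> carrier_vec n"
    and X: "X = c \<cdot>\<^sub>m 1\<^sub>m n + outer_prod p q" and Y: "Y = c \<cdot>\<^sub>m 1\<^sub>m n + outer_prod p' q'"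
    and tr: "mat_trace X = mat_trace Y"
    and fr: "mat_trace (X * mat_adjoint X) = mat_trace (Y * mat_adjoint Y)"
  shows "unitarily_similar n X Y"
proof -
  have "p \<bullet>c q = p' \<bullet>c q'"
    using tr by (simp add: X Y mat_trace_scalar_add_outer_prod[OF p q]
        mat_trace_scalar_add_outer_prod[OF p' q'])
  moreover from this have "(p \<bullet>c p) * (q \<bullet>c q) = (p' \<bullet>c p') * (q' \<bullet>c q')"
    using fr by (simp add: X Y frobenius_scalar_add_outer_prod[OF p q]
        frobenius_scalar_add_outer_prod[OF p' q'])
  ultimately show ?thesis
    unfolding X Y by (intro unitarily_similar_add_scalar outer_prod_unitarily_similar p q p' q')
qed

section \<open>Recognising outer products\<close>

text \<open>
  Any two distinct columns are linearly dependent, and both coefficients of a dependency annihilate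
  the minor.
\<close>

lemma (in vec_space) rank_le_1_minors_zero:
  assumes A: "A \<in> carrier_mat n nc" and rk: "rank A \<le> 1"
    and ij: "i < n" "k < n" "j < nc" "l < nc"
  shows "A $$ (i, j) * A $$ (k, l) = A $$ (i, l) * A $$ (k, j)"
proof (cases "col A j = col A l")
  case True
  hence "A $$ (m, j) = A $$ (m, l)" if "m < n" for m
    using that A ij by (metis index_col carrier_matD)
  thus ?thesis using ij by (simp add: mult.commute)
next
  case False
  let ?S = "{col A j, col A l}"
  have S: "?S \<subseteq> carrier_vec n" using A by auto
  have "lin_dep ?S"
  proof (rule ccontr)
    assume "\<not> lin_dep ?S"
    moreover have "?S \<subseteq> set (cols A)" using A ij by (auto simp: cols_def)
    ultimately have "card ?S \<le> rank A" by (intro rank_ge_card_indpt[OF A]) auto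
    thus False using False rk by simp
  qed
  then obtain a w where a: "lincomb a ?S = 0\<^sub>v n" "w \<in> ?S" "a w \<noteq> 0"
    using finite_lin_dep[of ?S] S by auto
  have lc: "a (col A j) * A $$ (m, j) + a (col A l) * A $$ (m, l) = 0" if "m < n" for m
    using lincomb_index[OF that S, of a] a(1) that False A ij by simp
  define b d where "b = a (col A j)" and "d = a (col A l)"
  have "b * A $$ (i, j) + d * A $$ (i, l) = 0" "b * A $$ (k, j) + d * A $$ (k, l) = 0"
    using lc ij by (simp_all add: b_def d_def)
  hence eq: "A $$ (k, l) * (b * A $$ (i, j) + d * A $$ (i, l))
        - A $$ (i, l) * (b * A $$ (k, j) + d * A $$ (k, l)) = 0"
      "A $$ (i, j) * (b * A $$ (k, j) + d * A $$ (k, l))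
        - A $$ (k, j) * (b * A $$ (i, j) + d * A $$ (i, l)) = 0"
    by simp_all
  have "b * (A $$ (i, j) * A $$ (k, l) - A $$ (i, l) * A $$ (k, j)) = 0"
     and "d * (A $$ (i, j) * A $$ (k, l) - A $$ (i, l) * A $$ (k, j)) = 0"
    using eq by (simp_all add: algebra_simps)
  moreover have "b \<noteq> 0 \<or> d \<noteq> 0" using a(2,3) by (auto simp: b_def d_def)
  ultimately show ?thesis by auto
qed

text \<open>
  The column and the row through a nonzero entry are the two factors, once the row is divided by
  that entry.
\<close>

lemma outer_prod_if_minors_zero:
  assumes A: "A \<in> carrier_mat n m"
    and minors: "\<And>i k j l. i < n \<Longrightarrow> k < n \<Longrightarrow> j < m \<Longrightarrow> l < m \<Longrightarrow>
      A $$ (i, j) * A $$ (k, l) = A $$ (i, l) * A $$ (k, j)"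
  shows "\<exists>p \<in> carrier_vec n. \<exists>q \<in> carrier_vec m. A = outer_prod p q"
proof (cases "A = 0\<^sub>m n m")
  case True
  thus ?thesis
    by (intro bexI[of _ "0\<^sub>v n"] bexI[of _ "0\<^sub>v m"]) (auto simp: outer_prod_def)
next
  case False
  then obtain k l where kl: "k < n" "l < m" "A $$ (k, l) \<noteq> 0"
    using A by (metis carrier_matD eq_matI index_zero_mat)
  define q where "q = vec m (\<lambda>j. cnj (A $$ (k, j) / A $$ (k, l)))"
  have "A = outer_prod (col A l) q"
  proof (rule eq_matI)
    fix i j assume "i < dim_row (outer_prod (col A l) q)" "j < dim_col (outer_prod (col A l) q)"
    hence ij: "i < n" "j < m" using A by (auto simp: outer_prod_def q_def)
    show "A $$ (i, j) = outer_prod (col A l) q $$ (i, j)"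
      using ij kl A minors[OF ij(1) kl(1) ij(2) kl(2)]
      by (simp add: outer_prod_def q_def field_simps)
  qed (use A in \<open>auto simp: outer_prod_def q_def\<close>)
  thus ?thesis using A by (intro bexI[of _ "col A l"] bexI[of _ q]) (auto simp: q_def)
qed

lemma outer_prod_if_det2_zero:
  fixes c :: complex
  assumes A: "A \<in> carrier_mat 2 2"
    and det: "(A $$ (0, 0) - c) * (A $$ (1, 1) - c) = A $$ (0, 1) * A $$ (1, 0)"
  shows "\<exists>p \<in> carrier_vec 2. \<exists>q \<in> carrier_vec 2. A = c \<cdot>\<^sub>m 1\<^sub>m 2 + outer_prod p q"
proof -
  define M where "M = A - c \<cdot>\<^sub>m 1\<^sub>m 2"
  have M: "M \<in> carrier_mat 2 2" by (simp add: M_def minus_carrier_mat)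
  have "M $$ (i, j) * M $$ (k, l) = M $$ (i, l) * M $$ (k, j)"
    if "i < 2" "k < 2" "j < 2" "l < 2" for i k j l
    using that det A by (auto simp: M_def less_2_cases_iff mult.commute)
  then obtain p q where "p \<in> carrier_vec 2" "q \<in> carrier_vec 2" "M = outer_prod p q"
    using outer_prod_if_minors_zero[OF M] by blast
  moreover have "A = c \<cdot>\<^sub>m 1\<^sub>m 2 + M"
    using A by (intro eq_matI) (auto simp: M_def)
  ultimately show ?thesis by blast
qed

section \<open>Products of normal matrices\<close>

lemma rank_le_1_unitarily_similar:
  assumes A: "A \<in> carrier_mat n n" and B: "B \<in> carrier_mat n n"
    and nA: "normal_mat A" and nB: "normal_mat B"
    and rk: "vec_space.rank n A \<le> 1"
  shows "unitarily_similar n (A * B) (B * A)"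
proof -
  obtain p q where p: "p \<in> carrier_vec n" and q: "q \<in> carrier_vec n" and Apq: "A = outer_prod p q"
    using outer_prod_if_minors_zero[OF A] vec_space.rank_le_1_minors_zero[OF A rk] by blast
  have "A * B = 0 \<cdot>\<^sub>m 1\<^sub>m n + outer_prod p (mat_adjoint B *\<^sub>v q)"
    using outer_prod_mult[OF B p q] mat_adjoint_carrier[OF B] B p q Apq
    by (intro eq_matI) (auto simp: outer_prod_def)
  moreover have "B * A = 0 \<cdot>\<^sub>m 1\<^sub>m n + outer_prod (B *\<^sub>v p) q"
    using mult_outer_prod[OF B p q] B p q Apq
    by (intro eq_matI) (auto simp: outer_prod_def)
  ultimately show ?thesis
    using p q mult_mat_vec_carrier[OF mat_adjoint_carrier[OF B] q] mult_mat_vec_carrier[OF B p]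
      mat_trace_mult_commute[OF A B] normal_products_same_frobenius_norm[OF A B nA nB]
    by (intro scalar_add_outer_prod_unitarily_similar)
qed

lemma dim_2_unitarily_similar:
  assumes A: "A \<in> carrier_mat 2 2" and B: "B \<in> carrier_mat 2 2"
    and nA: "normal_mat A" and nB: "normal_mat B"
  shows "unitarily_similar 2 (A * B) (B * A)"
proof -
  let ?X = "A * B" and ?Y = "B * A"
  have X: "?X \<in> carrier_mat 2 2" and Y: "?Y \<in> carrier_mat 2 2" using A B by auto
  define t where "t = ?X $$ (0, 0) + ?X $$ (1, 1)"
  define d where "d = ?X $$ (0, 0) * ?X $$ (1, 1) - ?X $$ (0, 1) * ?X $$ (1, 0)"
  \<comment> \<open>A root of the characteristic polynomial \<open>c\<^sup>2 - t c + d\<close>, which both products share.\<close>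
  define c where "c = (t + csqrt (t\<^sup>2 - 4 * d)) / 2"
  have entry: "(M * N) $$ (i, j) = M $$ (i, 0) * N $$ (0, j) + M $$ (i, 1) * N $$ (1, j)"
    if "M \<in> carrier_mat 2 2" "N \<in> carrier_mat 2 2" "i < 2" "j < 2" for M N :: "complex mat" and i j
    using that by (auto simp: scalar_prod_def numeral_2_eq_2)
  have tY: "?Y $$ (0, 0) + ?Y $$ (1, 1) = t"
    unfolding t_def by (simp add: entry[OF A B] entry[OF B A])
  have dY: "?Y $$ (0, 0) * ?Y $$ (1, 1) - ?Y $$ (0, 1) * ?Y $$ (1, 0) = d"
    unfolding d_def by (simp add: entry[OF A B] entry[OF B A] algebra_simps)
  have "2 * c - t = csqrt (t\<^sup>2 - 4 * d)" by (simp add: c_def field_simps)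
  hence "(2 * c - t)\<^sup>2 = t\<^sup>2 - 4 * d" by simp
  hence "4 * (c\<^sup>2 - t * c + d) = 0" by (simp add: power2_eq_square algebra_simps)
  hence root: "c\<^sup>2 - t * c + d = 0" unfolding mult_eq_0_iff by simp
  have shift: "(a - c) * (e - c) = m" if "a + e = t" "a * e - m = d" for a e m
  proof -
    have "(a - c) * (e - c) = (c\<^sup>2 - (a + e) * c + (a * e - m)) + m"
      by (simp add: power2_eq_square algebra_simps)
    thus ?thesis using root that by simp
  qed
  have "(?X $$ (0, 0) - c) * (?X $$ (1, 1) - c) = ?X $$ (0, 1) * ?X $$ (1, 0)"
    by (rule shift[OF t_def[symmetric] d_def[symmetric]])
  then obtain p q where "p \<in> carrier_vec 2" "q \<in> carrier_vec 2"
    "?X = c \<cdot>\<^sub>m 1\<^sub>m 2 + outer_prod p q"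
    using outer_prod_if_det2_zero[OF X] by blast
  moreover have "(?Y $$ (0, 0) - c) * (?Y $$ (1, 1) - c) = ?Y $$ (0, 1) * ?Y $$ (1, 0)"
    by (rule shift[OF tY dY])
  then obtain p' q' where "p' \<in> carrier_vec 2" "q' \<in> carrier_vec 2"
    "?Y = c \<cdot>\<^sub>m 1\<^sub>m 2 + outer_prod p' q'"
    using outer_prod_if_det2_zero[OF Y] by blast
  ultimately show ?thesis
    using mat_trace_mult_commute[OF A B] normal_products_same_frobenius_norm[OF A B nA nB]
    by (intro scalar_add_outer_prod_unitarily_similar)
qed

theorem proposition4p1:
  fixes n :: nat and A B :: "complex mat"
  assumes "A \<in> carrier_mat n n" and "B \<in> carrier_mat n n"
    and "normal_mat A" and "normal_mat B"
    and "n \<le> 2 \<or> vec_space.rank n A \<le> 1"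
  shows "unitarily_similar n (A * B) (B * A)"
proof (cases "vec_space.rank n A \<le> 1")
  case True
  thus ?thesis using assms by (intro rank_le_1_unitarily_similar)
next
  case False
  hence "n = 2" using assms(5) vec_space.rank_le_nc[OF assms(1)] by linarith
  thus ?thesis using dim_2_unitarily_similar assms by blast
qed

end
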